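(* There exists an indexed family of languages $\mathscr{L}$ that is identified by some HCEGIS engine but by no CEGIS engine; i.e. $\mathtt{HCEGIS}\not\subseteq\mathtt{CEGIS}$.
   Context: Languages are subsets of $\mathbb{N}$, ordered by the natural order of $\mathbb{N}$; $\overline{L}=\mathbb{N}\setminus L$. An indexed family of languages is a sequence $\mathscr{L}=L_0,L_1,\ldots$ of non-empty recursive languages for which there is a total recursive function $\mathtt{TEMPLATE}$ with $\mathtt{TEMPLATE}(i,n)=1$ if $n\in L_i$ and $0$ otherwise; the program $P_i$ is $n\mapsto\mathtt{TEMPLATE}(i,n)$, $\mathscr{P}=\{P_0,P_1,\ldots\}$, and $L(P_i)=L_i$. A sequence is a map $\sigma:\mathbb{N}\to\mathbb{N}\cup\{\bot\}$; $\sigma[k]$ is its prefix of length $k$, $\sigma(k)$ its $k$-th element, $\sigma_0$ the empty sequence, $\mathtt{SMPL}(\sigma)=\mathrm{range}(\sigma)\setminus\{\bot\}$. A trace for $L$ is a sequence $\tau$ with $\mathtt{SMPL}(\tau)=L$. A verifier $\mathtt{CHECK}_L$ is a (non-deterministic) map from $\mathscr{L}$ to $\mathbb{N}\cup\{\bot\}$ with $\mathtt{CHECK}_L(L_i)=\bot$ iff $L_i\subseteq L$ and otherwise $\mathtt{CHECK}_L(L_i)\in L_i\cap\overline{L}$. A history-bounded verifier $\mathtt{HCHECK}_L$ maps $L_i\in\mathscr{L}$ and a trace prefix $\tau[n]$ to $\mathbb{N}\cup\{\bot\}$: $\mathtt{HCHECK}_L(L_i,\tau[n])=m$ for some $m\in\overline{L}\cap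 L_i$ with $m<\tau(j)$ for some $j\le n$, if such $m$ exists, and $\bot$ otherwise. A CEGIS engine is given by a recursive $F:\mathscr{P}\times\mathbb{N}\times\mathbb{N}\to\mathscr{P}$ (counterexample argument may be $\bot$) and initial program $P_0$: $T(\sigma_0,\sigma_0)=P_0$, $T(\tau[n],\mathtt{cex}[n])=F(T(\tau[n-1],\mathtt{cex}[n-1]),\tau(n),\mathtt{cex}(n))$, where $\tau$ is a trace of the target language $L$ and $\mathtt{cex}(i)=\mathtt{CHECK}_L(L(T(\tau[i-1],\mathtt{cex}[i-1])))$. An HCEGIS engine is defined identically but with $\mathtt{cex}(i)=\mathtt{HCHECK}_L(L(T(\tau[i-1],\mathtt{cex}[i-1])),\tau[i-1])$. $T$ converges to $P_i$ on $(\tau,\mathtt{cex})$ if $T(\tau[n],\mathtt{cex}[n])=P_i$ for all sufficiently large $n$; $T$ identifies $L_i$ if it converges to $P_i$ for every trace $\tau$ of $L_i$ and every corresponding counterexample sequence; $T$ identifies $\mathscr{L}$ if it identifies every member. $\mathtt{CEGIS}$ (resp. $\mathtt{HCEGIS}$) is the class of indexed families identified by some CEGIS (resp. HCEGIS) engine. *)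

theory Defs
  imports Main
begin

text \<open>total_rec n f: f, restricted to argument lists of length n, is a total recursive
  function of n arguments. Built from zero, successor, projections by composition,
  primitive recursion and minimisation of regular functions (Kleene).\<close>

inductive total_rec :: "nat \<Rightarrow> (nat list \<Rightarrow> nat) \<Rightarrow> bool" where
  zero: "total_rec n (\<lambda>xs. 0)"
| succ: "total_rec 1 (\<lambda>xs. Suc (hd xs))"
| proj: "i < n \<Longrightarrow> total_rec n (\<lambda>xs. xs ! i)"
| comp: "total_rec m f \<Longrightarrow> length gs = m \<Longrightarrow> (\<forall>g\<in>set gs. total_rec n g) \<Longrightarrow>
           total_rec n (\<lambda>xs. f (map (\<lambda>g. g xs) gs))"
| prim: "total_rec n g \<Longrightarrow> total_rec (Suc (Suc n)) h \<Longrightarrow>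
           total_rec (Suc n) (\<lambda>xs. rec_nat (g (tl xs)) (\<lambda>k acc. h (k # acc # tl xs)) (hd xs))"
| mu: "total_rec (Suc n) g \<Longrightarrow> (\<forall>xs. length xs = n \<longrightarrow> (\<exists>y. g (y # xs) = 0)) \<Longrightarrow>
           total_rec n (\<lambda>xs. LEAST y. g (y # xs) = 0)"

definition enc_opt :: "nat option \<Rightarrow> nat" where
  "enc_opt x = (case x of None \<Rightarrow> 0 | Some k \<Rightarrow> Suc k)"

definition recursive2 :: "(nat \<Rightarrow> nat \<Rightarrow> nat) \<Rightarrow> bool" where
  "recursive2 f \<longleftrightarrow> (\<exists>g. total_rec 2 g \<and> (\<forall>a b. g [a, b] = f a b))"

definition recursive_F :: "(nat \<Rightarrow> nat option \<Rightarrow> nat option \<Rightarrow> nat) \<Rightarrow> bool" where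
  "recursive_F F \<longleftrightarrow>
     (\<exists>g. total_rec 3 g \<and> (\<forall>p x c. g [p, enc_opt x, enc_opt c] = F p x c))"

definition indexed_family :: "(nat \<Rightarrow> nat set) \<Rightarrow> bool" where
  "indexed_family \<L> \<longleftrightarrow> (\<forall>i. \<L> i \<noteq> {}) \<and>
     recursive2 (\<lambda>i n. if n \<in> \<L> i then 1 else 0)"

definition SMPL :: "(nat \<Rightarrow> nat option) \<Rightarrow> nat set" where
  "SMPL \<sigma> = {x. \<exists>k. \<sigma> k = Some x}"

definition is_trace :: "nat set \<Rightarrow> (nat \<Rightarrow> nat option) \<Rightarrow> bool" where
  "is_trace L \<tau> \<longleftrightarrow> SMPL \<tau> = L"

definition check_ok :: "nat set \<Rightarrow> nat set \<Rightarrow> nat option \<Rightarrow> bool" where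
  "check_ok L H c \<longleftrightarrow>
     (if H \<subseteq> L then c = None else (\<exists>m. c = Some m \<and> m \<in> H \<and> m \<notin> L))"

definition hcheck_ok :: "nat set \<Rightarrow> nat set \<Rightarrow> nat set \<Rightarrow> nat option \<Rightarrow> bool" where
  "hcheck_ok L H hist c \<longleftrightarrow>
     (if (\<exists>m. m \<in> H \<and> m \<notin> L \<and> (\<exists>t\<in>hist. m < t))
      then (\<exists>m. c = Some m \<and> m \<in> H \<and> m \<notin> L \<and> (\<exists>t\<in>hist. m < t))
      else c = None)"

definition history :: "(nat \<Rightarrow> nat option) \<Rightarrow> nat \<Rightarrow> nat set" where
  "history \<tau> n = {t. \<exists>j<n. \<tau> j = Some t}"

text \<open>Programs are represented by their indices: index p stands for P_p.
  run F p0 \<tau> cex n is the (index of the) program after consuming \<tau>(0..n-1) and cex(0..n-1).\<close>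
fun run :: "(nat \<Rightarrow> nat option \<Rightarrow> nat option \<Rightarrow> nat) \<Rightarrow> nat \<Rightarrow>
            (nat \<Rightarrow> nat option) \<Rightarrow> (nat \<Rightarrow> nat option) \<Rightarrow> nat \<Rightarrow> nat" where
  "run F p0 \<tau> cex 0 = p0"
| "run F p0 \<tau> cex (Suc n) = F (run F p0 \<tau> cex n) (\<tau> n) (cex n)"

text \<open>F is a well-defined recursive map on programs: programs P_p, P_q are equal (as
  functions) iff their languages coincide, so F must respect this equality.\<close>
definition engine :: "(nat \<Rightarrow> nat set) \<Rightarrow> (nat \<Rightarrow> nat option \<Rightarrow> nat option \<Rightarrow> nat) \<Rightarrow> bool" where
  "engine \<L> F \<longleftrightarrow> recursive_F F \<and>
     (\<forall>p q x c. \<L> p = \<L> q \<longrightarrow> \<L> (F p x c) = \<L> (F q x c))"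

definition converges_to :: "(nat \<Rightarrow> nat set) \<Rightarrow> (nat \<Rightarrow> nat) \<Rightarrow> nat \<Rightarrow> bool" where
  "converges_to \<L> h i \<longleftrightarrow> (\<exists>N. \<forall>n\<ge>N. \<L> (h n) = \<L> i)"

definition cegis_identifies ::
  "(nat \<Rightarrow> nat set) \<Rightarrow> (nat \<Rightarrow> nat option \<Rightarrow> nat option \<Rightarrow> nat) \<Rightarrow> nat \<Rightarrow> bool" where
  "cegis_identifies \<L> F p0 \<longleftrightarrow>
     (\<forall>i \<tau> cex. is_trace (\<L> i) \<tau> \<longrightarrow>
        (\<forall>n. check_ok (\<L> i) (\<L> (run F p0 \<tau> cex n)) (cex n)) \<longrightarrow>
        converges_to \<L> (run F p0 \<tau> cex) i)"

definition hcegis_identifies ::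
  "(nat \<Rightarrow> nat set) \<Rightarrow> (nat \<Rightarrow> nat option \<Rightarrow> nat option \<Rightarrow> nat) \<Rightarrow> nat \<Rightarrow> bool" where
  "hcegis_identifies \<L> F p0 \<longleftrightarrow>
     (\<forall>i \<tau> cex. is_trace (\<L> i) \<tau> \<longrightarrow>
        (\<forall>n. hcheck_ok (\<L> i) (\<L> (run F p0 \<tau> cex n)) (history \<tau> n) (cex n)) \<longrightarrow>
        converges_to \<L> (run F p0 \<tau> cex) i)"

definition in_CEGIS :: "(nat \<Rightarrow> nat set) \<Rightarrow> bool" where
  "in_CEGIS \<L> \<longleftrightarrow> indexed_family \<L> \<and> (\<exists>F p0. engine \<L> F \<and> cegis_identifies \<L> F p0)"

definition in_HCEGIS :: "(nat \<Rightarrow> nat set) \<Rightarrow> bool" where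
  "in_HCEGIS \<L> \<longleftrightarrow> indexed_family \<L> \<and> (\<exists>F p0. engine \<L> F \<and> hcegis_identifies \<L> F p0)"

end

theory Submission
  imports Defs "HOL-Library.Nat_Bijection"
begin

text \<open>
  The family consists of three infinite decoys \<open>decoy t\<close> and of finite languages \<open>fin i q\<close> of kind \<open>i\<close>.
  The kind fixes a private odd marker \<open>2 * i + 7\<close> and a finite set \<open>E\<^sub>i\<close> of even numbers, every finite set
  occurring for infinitely many kinds; \<open>fin i 0\<close> is \<open>E\<^sub>i\<close> with the marker, and \<open>fin i q\<close> for \<open>q > 0\<close> has
  two further even elements, \<open>a\<^sub>i\<close> and \<open>y = 2 * i + 2 * q + 6\<close>, where \<open>a\<^sub>i\<close> lies below the marker and \<open>y\<close> above
  it. Apart from \<open>fin i 0 \<subseteq> fin i q\<close> no member contains another.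

  With history-bounded counterexamples, the learner waits in a decoy for the marker and then tries
  \<open>fin i 1\<close>, \<open>fin i 2\<close>, ... If the target is \<open>fin i 0\<close>, then \<open>a\<^sub>i\<close> is the only counterexample below the
  largest element of the target, so it is reported at once. Otherwise the true \<open>y\<close> bounds the history
  and the search stops there.

  With unbounded counterexamples, \<open>a\<^sub>i\<close> need never be reported. A learner must visit each decoy \<open>t\<close> on every
  trace of it, and when it is then refuted it has forgotten all examples. If the learner has seen
  exactly \<open>a\<^sub>i\<close>, \<open>y\<close> and elements of \<open>E\<^sub>i\<close>, it confuses \<open>fin i 0\<close> with \<open>fin i q\<close>, unless it happens to visit
  \<open>fin i q\<close> later (which for each \<open>i\<close> concerns finitely many \<open>q\<close> only) or has refuted kind \<open>i\<close> before
  (finitely many \<open>i\<close> only). Choosing new large values \<open>y\<close> over and over yields a trace of the decoy all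
  of whose prefixes are of this sort, so the decoy is never visited.
\<close>

section \<open>Closure properties of total recursive functions\<close>

text \<open>The clauses of \<open>total_rec\<close> also fix values on lists of other lengths.
  Demanding agreement only on lists of length \<open>n\<close> makes the notion invariant under
  rewriting.\<close>

definition computable :: "nat \<Rightarrow> (nat list \<Rightarrow> nat) \<Rightarrow> bool" where
  "computable n f \<longleftrightarrow> (\<exists>g. total_rec n g \<and> (\<forall>xs. length xs = n \<longrightarrow> g xs = f xs))"

lemma computable_cong:
  assumes "computable n f" "\<And>xs. length xs = n \<Longrightarrow> f xs = g xs"
  shows "computable n g"
  using assms unfolding computable_def by metis

lemma computable_nth: "i < n \<Longrightarrow> computable n (\<lambda>xs. xs ! i)"
  unfolding computable_def using total_rec.proj by blast

lemma computable_comp: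
  assumes f: "computable (length gs) f" and gs: "\<forall>g\<in>set gs. computable n g"
  shows "computable n (\<lambda>xs. f (map (\<lambda>g. g xs) gs))"
proof -
  obtain f' where f': "total_rec (length gs) f'" "\<And>xs. length xs = length gs \<Longrightarrow> f' xs = f xs"
    using f unfolding computable_def by blast
  obtain r where r: "\<And>g. g \<in> set gs \<Longrightarrow> total_rec n (r g) \<and> (\<forall>xs. length xs = n \<longrightarrow> r g xs = g xs)"
    using gs unfolding computable_def by metis
  have "total_rec n (\<lambda>xs. f' (map (\<lambda>g. g xs) (map r gs)))"
    by (rule total_rec.comp[OF f'(1)]) (use r in auto)
  moreover have "f' (map (\<lambda>g. g xs) (map r gs)) = f (map (\<lambda>g. g xs) gs)" if "length xs = n" for xs
  proof -
    have "map (\<lambda>g. g xs) (map r gs) = map (\<lambda>g. g xs) gs"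
      using r that by auto
    then show ?thesis using f'(2)[of "map (\<lambda>g. g xs) gs"] by (metis length_map)
  qed
  ultimately show ?thesis unfolding computable_def by blast
qed

lemma computable_comp1:
  assumes "computable 1 (\<lambda>xs. f (xs ! 0))" "computable n g"
  shows "computable n (\<lambda>xs. f (g xs))"
  using computable_comp[of "[g]" "\<lambda>xs. f (xs ! 0)" n] assms by simp

lemma computable_comp2:
  assumes "computable 2 (\<lambda>xs. f (xs ! 0) (xs ! 1))" "computable n g" "computable n h"
  shows "computable n (\<lambda>xs. f (g xs) (h xs))"
  using computable_comp[of "[g, h]" "\<lambda>xs. f (xs ! 0) (xs ! 1)" n] assms by (simp add: numeral_2_eq_2)

lemma computable_Suc: "computable n f \<Longrightarrow> computable n (\<lambda>xs. Suc (f xs))"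
proof (rule computable_comp1[where f = Suc])
  show "computable 1 (\<lambda>xs. Suc (xs ! 0))"
    unfolding computable_def
    by (intro exI[of _ "\<lambda>xs. Suc (hd xs)"] conjI total_rec.succ) (auto simp: length_Suc_conv)
qed

lemma computable_const: "computable n (\<lambda>xs. c)"
proof (induction c)
  case 0
  show ?case unfolding computable_def using total_rec.zero by blast
next
  case (Suc c)
  then show ?case by (rule computable_Suc)
qed

text \<open>The recursion variable comes first, whence the swapped arguments for power and
  subtraction below.\<close>

lemma computable_prim_rec:
  assumes b: "computable 1 (\<lambda>xs. b (xs ! 0))"
    and s: "computable 3 (\<lambda>xs. s (xs ! 0) (xs ! 1) (xs ! 2))"
    and f: "\<And>y. f 0 y = b y" "\<And>k y. f (Suc k) y = s k (f k y) y"
  shows "computable 2 (\<lambda>xs. f (xs ! 0) (xs ! 1))"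
proof -
  obtain b' where b': "total_rec 1 b'" "\<And>y. b' [y] = b y"
    using b unfolding computable_def by force
  obtain s' where s': "total_rec 3 s'" "\<And>x y z. s' [x, y, z] = s x y z"
    using s unfolding computable_def by (force simp: numeral_3_eq_3)
  have "total_rec (Suc 1) (\<lambda>xs. rec_nat (b' (tl xs)) (\<lambda>k acc. s' (k # acc # tl xs)) (hd xs))"
    by (rule total_rec.prim) (use b' s' in \<open>simp_all add: numeral_3_eq_3\<close>)
  moreover have "rec_nat (b' [y]) (\<lambda>k acc. s' [k, acc, y]) x = f x y" for x y
    by (induction x) (simp_all add: b' s' f)
  ultimately show ?thesis
    unfolding computable_def
    by (intro exI conjI) (auto simp: numeral_2_eq_2 length_Suc_conv)
qed

lemma computable_Least:
  assumes g: "computable (Suc n) g" and ex: "\<And>xs. length xs = n \<Longrightarrow> \<exists>y. g (y # xs) = 0"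
  shows "computable n (\<lambda>xs. LEAST y. g (y # xs) = 0)"
proof -
  obtain g' where g': "total_rec (Suc n) g'" "\<And>xs. length xs = Suc n \<Longrightarrow> g' xs = g xs"
    using g unfolding computable_def by blast
  have "total_rec n (\<lambda>xs. LEAST y. g' (y # xs) = 0)"
    by (rule total_rec.mu[OF g'(1)]) (use g'(2) ex in auto)
  then show ?thesis
    unfolding computable_def
    by (intro exI[of _ "\<lambda>xs. LEAST y. g' (y # xs) = 0"]) (simp add: g'(2))
qed

lemma computable_add: "computable n f \<Longrightarrow> computable n g \<Longrightarrow> computable n (\<lambda>xs. f xs + g xs)"
proof (rule computable_comp2[where f = "(+)"])
  show "computable 2 (\<lambda>xs. xs ! 0 + xs ! 1)"
    by (rule computable_prim_rec[where f = "(+)" and b = "\<lambda>y. y" and s = "\<lambda>k r y. Suc r"])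
      (intro computable_nth computable_Suc | simp)+
qed

lemma computable_mult: "computable n f \<Longrightarrow> computable n g \<Longrightarrow> computable n (\<lambda>xs. f xs * g xs)"
proof (rule computable_comp2[where f = "(*)"])
  show "computable 2 (\<lambda>xs. xs ! 0 * xs ! 1)"
    by (rule computable_prim_rec[where f = "(*)" and b = "\<lambda>y. 0" and s = "\<lambda>k r y. r + y"])
      (intro computable_nth computable_const computable_add | simp)+
qed

lemma computable_power: "computable n f \<Longrightarrow> computable n g \<Longrightarrow> computable n (\<lambda>xs. f xs ^ g xs)"
proof (rule computable_comp2[where f = "\<lambda>k y. y ^ k"])
  show "computable 2 (\<lambda>xs. xs ! 1 ^ xs ! 0)"
    by (rule computable_prim_rec[where f = "\<lambda>k y. y ^ k" and b = "\<lambda>y. 1" and s = "\<lambda>k r y. y * r"])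
      (intro computable_nth computable_const computable_mult | simp)+
qed

lemma computable_diff: "computable n f \<Longrightarrow> computable n g \<Longrightarrow> computable n (\<lambda>xs. f xs - g xs)"
proof (rule computable_comp2[where f = "\<lambda>k y. y - k"])
  \<comment> \<open>The predecessor returns the recursion counter; a dummy second argument fits it
    to the binary scheme. Subtraction iterates it.\<close>
  have "computable 2 (\<lambda>xs. xs ! 0 - 1)"
    by (rule computable_prim_rec[where f = "\<lambda>x y. x - 1" and b = "\<lambda>y. 0" and s = "\<lambda>k r y. k"])
      (intro computable_nth computable_const | simp)+
  then have "computable m h \<Longrightarrow> computable m (\<lambda>xs. h xs - 1)" for m h
    using computable_comp2[where f = "\<lambda>x y. x - 1" and h = h] by blast
  note pred = this
  show "computable 2 (\<lambda>xs. xs ! 1 - xs ! 0)"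
    by (rule computable_prim_rec[where f = "\<lambda>k y. y - k" and b = "\<lambda>y. y" and s = "\<lambda>k r y. r - 1"])
      (intro computable_nth pred | simp)+
qed

section \<open>Decidable predicates and bounded arithmetic\<close>

definition decidable :: "nat \<Rightarrow> (nat list \<Rightarrow> bool) \<Rightarrow> bool" where
  "decidable n P \<longleftrightarrow> computable n (\<lambda>xs. if P xs then 1 else 0)"

lemma computable_if:
  assumes "decidable n P" "computable n f" "computable n g"
  shows "computable n (\<lambda>xs. if P xs then f xs else g xs)"
proof -
  have "computable n (\<lambda>xs. (if P xs then 1 else 0) * f xs + (1 - (if P xs then 1 else 0)) * g xs)"
    using assms unfolding decidable_def
    by (intro computable_add computable_mult computable_diff computable_const)
  then show ?thesis by (rule computable_cong) auto
qed

lemma decidable_le: "computable n f \<Longrightarrow> computable n g \<Longrightarrow> decidable n (\<lambda>xs. f xs \<le> g xs)"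
  unfolding decidable_def
  by (rule computable_cong[where f = "\<lambda>xs. 1 - (f xs - g xs)"])
    (auto intro: computable_diff computable_const)

lemma decidable_not: "decidable n P \<Longrightarrow> decidable n (\<lambda>xs. \<not> P xs)"
  unfolding decidable_def
  by (rule computable_cong[where f = "\<lambda>xs. 1 - (if P xs then 1 else 0)"])
    (auto intro: computable_diff computable_const)

lemma decidable_conj: "decidable n P \<Longrightarrow> decidable n Q \<Longrightarrow> decidable n (\<lambda>xs. P xs \<and> Q xs)"
  unfolding decidable_def
  by (rule computable_cong[where f = "\<lambda>xs. (if P xs then 1 else 0) * (if Q xs then 1 else 0)"])
    (auto intro: computable_mult)

lemma decidable_disj: "decidable n P \<Longrightarrow> decidable n Q \<Longrightarrow> decidable n (\<lambda>xs. P xs \<or> Q xs)"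
  using decidable_not[OF decidable_conj[OF decidable_not decidable_not], of n P Q] by simp

lemma decidable_less: "computable n f \<Longrightarrow> computable n g \<Longrightarrow> decidable n (\<lambda>xs. f xs < g xs)"
  using decidable_not[OF decidable_le, of n g f] by (simp add: not_le)

lemma decidable_eq: "computable n f \<Longrightarrow> computable n g \<Longrightarrow> decidable n (\<lambda>xs. f xs = g xs)"
  using decidable_conj[OF decidable_le decidable_le, of n f g g f] by (simp add: eq_iff)

lemma computable_LEAST:
  assumes P: "decidable (Suc n) (\<lambda>xs. P (hd xs) (tl xs))"
    and ex: "\<And>xs. length xs = n \<Longrightarrow> \<exists>y. P y xs"
  shows "computable n (\<lambda>xs. LEAST y. P y xs)"
proof -
  have "computable (Suc n) (\<lambda>xs. if P (hd xs) (tl xs) then 0 else 1)"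
    by (intro computable_if P computable_const)
  moreover have "((if P y xs then 0 else 1) = (0 :: nat)) = P y xs" for y xs by simp
  ultimately show ?thesis
    using computable_Least[of n "\<lambda>xs. if P (hd xs) (tl xs) then 0 else 1"] ex
    by (simp only: list.sel)
qed

text \<open>The quotient is the least \<open>y\<close> with \<open>a < b * Suc y\<close>; the
  disjunct for \<open>b = 0\<close> makes the search total and yields the value 0 of
  \<open>div\<close> there.\<close>

lemma computable_div:
  assumes "computable n f" "computable n g"
  shows "computable n (\<lambda>xs. f xs div g xs)"
proof (rule computable_comp2[OF _ assms])
  have "computable 2 (\<lambda>xs. LEAST y. xs ! 1 = 0 \<or> xs ! 0 < xs ! 1 * Suc y)"
  proof (rule computable_LEAST)
    have "decidable 3 (\<lambda>xs. xs ! 2 = 0 \<or> xs ! 1 < xs ! 2 * Suc (xs ! 0))"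
      by (intro decidable_disj decidable_eq decidable_less computable_mult computable_Suc
          computable_const computable_nth) auto
    then have "decidable (Suc 2) (\<lambda>xs. xs ! 2 = 0 \<or> xs ! 1 < xs ! 2 * Suc (xs ! 0))"
      by (simp add: numeral_3_eq_3 numeral_2_eq_2)
    then show "decidable (Suc 2) (\<lambda>xs. tl xs ! 1 = 0 \<or> tl xs ! 0 < tl xs ! 1 * Suc (hd xs))"
      unfolding decidable_def
      by (rule computable_cong) (auto simp: length_Suc_conv numeral_2_eq_2)
    show "\<exists>y. xs ! 1 = 0 \<or> xs ! 0 < xs ! 1 * Suc y" for xs :: "nat list"
      by (rule exI[of _ "xs ! 0"]) (cases "xs ! 1"; simp)
  qed
  moreover have "(LEAST y. b = 0 \<or> a < b * Suc y) = a div b" for a b :: nat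
  proof (rule Least_equality)
    show "b = 0 \<or> a < b * Suc (a div b)"
      using dividend_less_times_div[of b a] by (cases "b = 0") auto
    show "a div b \<le> y" if "b = 0 \<or> a < b * Suc y" for y
      using that by (auto simp: less_mult_imp_div_less mult.commute simp flip: less_Suc_eq_le)
  qed
  ultimately show "computable 2 (\<lambda>xs. xs ! 0 div xs ! 1)" by simp
qed

lemma decidable_even: "computable n f \<Longrightarrow> decidable n (\<lambda>xs. even (f xs))"
  unfolding even_iff_mod_2_eq_zero
proof -
  assume f: "computable n f"
  have "decidable n (\<lambda>xs. f xs \<le> 2 * (f xs div 2))"
    by (intro decidable_le computable_mult computable_div computable_const f)
  then show "decidable n (\<lambda>xs. f xs mod 2 = 0)"
    unfolding decidable_def by (rule computable_cong) (simp, presburger)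
qed

lemmas computable_intros =
  computable_nth computable_const computable_Suc computable_add computable_mult computable_power
  computable_diff computable_div computable_if decidable_le decidable_less decidable_eq
  decidable_not decidable_conj decidable_disj decidable_even

section \<open>The family\<close>

text \<open>Positive numbers are uniquely a power of two times an odd number, so pairs are coded by
  the numbers from 3 on; 0, 1, 2 remain for the decoys.\<close>

definition idx :: "nat \<Rightarrow> nat \<Rightarrow> nat" where
  "idx i q = 2 + 2 ^ q * (2 * i + 1)"

text \<open>The 2-adic valuation, with value 0 at 0 so that the search always ends.\<close>

definition val2 :: "nat \<Rightarrow> nat" where
  "val2 n = (LEAST y. n = 0 \<or> odd (n div 2 ^ y))"

definition odd_part :: "nat \<Rightarrow> nat" where
  "odd_part n = n div 2 ^ val2 n"

definition ext :: "nat \<Rightarrow> nat" where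
  "ext p = val2 (p - 2)"

definition kind :: "nat \<Rightarrow> nat" where
  "kind p = odd_part (p - 2) div 2"

text \<open>The element \<open>a\<^sub>i\<close> is \<open>2 * hole i + 6\<close>, and \<open>E\<^sub>i\<close> is read off the binary digits of \<open>i\<close> at even
  positions; the odd positions are free, which makes every finite set occur infinitely often. The
  offset 3 keeps \<open>a\<^sub>i\<close> off the numbers 0, 2, 4 that tell the decoys apart.\<close>

definition hole :: "nat \<Rightarrow> nat" where
  "hole i = (LEAST k. even (i div 4 ^ (k + 3)))"

definition decoy :: "nat \<Rightarrow> nat set" where
  "decoy t = {x. even x \<and> (6 \<le> x \<or> x = 2 * t)}"

definition fin :: "nat \<Rightarrow> nat \<Rightarrow> nat set" where
  "fin i q = {x. x = 2 * i + 7 \<or> even x \<and> (odd (i div 4 ^ (x div 2)) \<or>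
     0 < q \<and> (x = 2 * hole i + 6 \<or> x = 2 * i + 2 * q + 6))}"

definition lang :: "nat \<Rightarrow> nat set" where
  "lang p = (if p < 3 then decoy p else fin (kind p) (ext p))"

lemma val2_eq: "odd m \<Longrightarrow> val2 (2 ^ q * m) = q"
  unfolding val2_def
proof (rule Least_equality)
  assume m: "odd m"
  then show "2 ^ q * m = 0 \<or> odd (2 ^ q * m div 2 ^ q)" by simp
  show "q \<le> y" if y: "2 ^ q * m = 0 \<or> odd (2 ^ q * m div 2 ^ y)" for y
  proof (rule ccontr)
    assume "\<not> q \<le> y"
    then obtain d where "q = y + Suc d" by (metis less_imp_Suc_add not_le add_Suc_right)
    then have "2 ^ q * m = 2 ^ y * (2 * (2 ^ d * m))" by (simp add: power_add)
    then have "2 ^ q * m div 2 ^ y = 2 * (2 ^ d * m)"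
      by (metis nonzero_mult_div_cancel_left power_not_zero zero_neq_numeral)
    then have "even (2 ^ q * m div 2 ^ y)" by simp
    then show False using y m by (auto elim: oddE)
  qed
qed

lemma odd_part_eq: "odd m \<Longrightarrow> odd_part (2 ^ q * m) = m"
  by (simp add: odd_part_def val2_eq)

lemma ext_idx [simp]: "ext (idx i q) = q"
  by (simp add: ext_def idx_def val2_eq del: mult_Suc_right)

lemma odd_part_idx [simp]: "odd_part (idx i q - 2) = 2 * i + 1"
  by (simp add: idx_def odd_part_eq del: mult_Suc_right)

lemma kind_idx [simp]: "kind (idx i q) = i"
  by (simp add: kind_def)

lemma idx_ge: "3 \<le> idx i q"
proof -
  have "0 < 2 ^ q * (2 * i + 1)" by simp
  then show ?thesis unfolding idx_def by linarith
qed

lemma idx_surj: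
  assumes "3 \<le> p"
  obtains i q where "p = idx i q"
proof -
  have "\<exists>q m. n = 2 ^ q * m \<and> odd m" if "0 < n" for n :: nat
    using that
  proof (induction n rule: less_induct)
    case (less n)
    show ?case
    proof (cases "odd n")
      case True
      then show ?thesis by (intro exI[of _ 0] exI[of _ n]) simp
    next
      case False
      then obtain k where k: "n = 2 * k" by auto
      moreover have "0 < k" "k < n" using k less.prems by auto
      ultimately obtain q m where "k = 2 ^ q * m \<and> odd m" using less.IH by blast
      then have "n = 2 ^ Suc q * m \<and> odd m" using k by simp
      then show ?thesis by blast
    qed
  qed
  from this[of "p - 2"] obtain q m where "p - 2 = 2 ^ q * m" "odd m" using assms by auto
  then have "p = idx (m div 2) q" using assms unfolding idx_def by simp
  then show thesis by (rule that)
qed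

lemma idx_eq_iff [simp]: "idx i q = idx j r \<longleftrightarrow> i = j \<and> q = r"
  by (metis kind_idx ext_idx)

lemma lang_idx [simp]: "lang (idx i q) = fin i q"
  using idx_ge[of i q] by (simp add: lang_def)

lemma lang_decoy: "t < 3 \<Longrightarrow> lang t = decoy t"
  by (simp add: lang_def)

section \<open>Membership and position of the elements\<close>

lemma less_pow4: "n < (4 :: nat) ^ n"
  by (induction n) auto

text \<open>For \<open>i \<le> n\<close> the quotient is 0, as \<open>i < 4 ^ n\<close>. So
  \<open>E\<^sub>i\<close> is finite and lies below the marker.\<close>

lemma bit4_less: "odd (i div 4 ^ n) \<Longrightarrow> n < i"
  by (metis div_less even_zero leI less_le_trans less_pow4 not_less)

lemma even_hole: "even (i div 4 ^ (hole i + 3))"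
  unfolding hole_def by (rule LeastI[of _ i]) (metis bit4_less le_add1 not_less)

lemma hole_le: "hole i \<le> i"
  unfolding hole_def by (rule Least_le) (metis bit4_less le_add1 not_less)

lemma odd_mem_fin: "odd x \<Longrightarrow> x \<in> fin i q \<longleftrightarrow> x = 2 * i + 7"
  by (auto simp: fin_def)

lemma marker_mem_fin [simp]: "2 * j + 7 \<in> fin i q \<longleftrightarrow> j = i"
  by (auto simp: fin_def)

lemma even_mem_fin:
  "2 * n \<in> fin i q \<longleftrightarrow> odd (i div 4 ^ n) \<or> 0 < q \<and> (n = hole i + 3 \<or> n = i + q + 3)"
proof -
  have "2 * n \<noteq> 2 * i + 7" by presburger
  moreover have "2 * n = 2 * hole i + 6 \<longleftrightarrow> n = hole i + 3" "2 * n = 2 * i + 2 * q + 6 \<longleftrightarrow> n = i + q + 3"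
    by auto
  ultimately show ?thesis by (simp add: fin_def)
qed

lemma fin_mono: "fin i 0 \<subseteq> fin i q"
  by (auto simp: fin_def)

text \<open>The half \<open>i + r + 3\<close> exceeds \<open>hole i + 3\<close> and the halves of
  all members of \<open>E\<^sub>i\<close>, so only the \<open>y\<close> of \<open>fin i r\<close>
  can equal it. Hence the \<open>fin i q\<close> with \<open>q > 0\<close> are pairwise
  incomparable.\<close>

lemma fin_extra: "0 < r \<Longrightarrow> 2 * i + 2 * r + 6 \<in> fin i q \<longleftrightarrow> q = r"
proof -
  assume r: "0 < r"
  have "2 * i + 2 * r + 6 = 2 * (i + r + 3)" by simp
  moreover have "2 * (i + r + 3) \<in> fin i q \<longleftrightarrow> q = r"
    unfolding even_mem_fin using bit4_less[of i "i + r + 3"] hole_le[of i] r by auto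
  ultimately show ?thesis by simp
qed

lemma fin_hole: "2 * hole i + 6 \<in> fin i q \<longleftrightarrow> 0 < q"
proof -
  have "2 * hole i + 6 = 2 * (hole i + 3)" by simp
  moreover have "2 * (hole i + 3) \<in> fin i q \<longleftrightarrow> 0 < q"
    unfolding even_mem_fin using even_hole[of i] hole_le[of i] by auto
  ultimately show ?thesis by simp
qed

lemma fin_diff:
  assumes "x \<in> fin i q" "x \<notin> fin i r"
  shows "0 < q" "r = 0 \<and> x = 2 * hole i + 6 \<or> x = 2 * i + 2 * q + 6"
  using assms by (auto simp: fin_def)

lemma mem_decoy [simp]: "2 * n \<in> decoy t \<longleftrightarrow> 3 \<le> n \<or> n = t"
  by (auto simp: decoy_def)

lemma decoy_even: "x \<in> decoy t \<Longrightarrow> even x"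
  by (simp add: decoy_def)

text \<open>Decoys differ on 0, 2, 4; the marker reveals the kind and \<open>y\<close> reveals
  \<open>q\<close>. Thus convergence of languages is convergence of indices, and every
  \<open>F\<close> respects equality of programs.\<close>

lemma inj_lang: "lang p = lang q \<Longrightarrow> p = q"
proof -
  have decoy: "p = q" if "p < 3" "lang p = lang q" for p q
  proof (cases "q < 3")
    case True
    have "2 * p \<in> decoy p" by simp
    moreover have "decoy p = decoy q" using that True by (simp add: lang_decoy)
    ultimately have "3 \<le> p \<or> p = q" by (metis mem_decoy)
    then show ?thesis using that(1) by simp
  next
    case False
    then obtain i r where q: "q = idx i r" using idx_surj[of q] by force
    have "2 * i + 7 \<in> decoy p" using that q by (simp add: lang_decoy)
    then show ?thesis using decoy_even[of "2 * i + 7" p] by simp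
  qed
  assume eq: "lang p = lang q"
  show "p = q"
  proof (cases "p < 3 \<or> q < 3")
    case True
    then show ?thesis using decoy[of p q] decoy[of q p] eq by auto
  next
    case False
    then obtain i r j s where pq: "p = idx i r" "q = idx j s"
      using idx_surj[of p] idx_surj[of q] by (metis not_le)
    then have f: "fin i r = fin j s" using eq by simp
    then have ij: "i = j" using marker_mem_fin[of i i r] by simp
    have "r = s"
    proof (cases "0 < r")
      case True
      then show ?thesis using f ij fin_extra[of r i r] fin_extra[of r i s] by simp
    next
      case False
      then show ?thesis using f ij fin_extra[of s i r] fin_extra[of s i s] by (cases "0 < s") auto
    qed
    then show ?thesis using ij pq by simp
  qed
qed

section \<open>Computability of the family\<close>

lemma computable_val2: "computable n f \<Longrightarrow> computable n (\<lambda>xs. val2 (f xs))"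
proof (rule computable_comp1[where f = val2])
  show "computable 1 (\<lambda>xs. val2 (xs ! 0))"
    unfolding val2_def
  proof (rule computable_LEAST)
    have "decidable (Suc 1) (\<lambda>xs. xs ! 1 = 0 \<or> \<not> even (xs ! 1 div 2 ^ (xs ! 0)))"
      by (intro computable_intros) auto
    then show "decidable (Suc 1) (\<lambda>xs. tl xs ! 0 = 0 \<or> odd (tl xs ! 0 div 2 ^ hd xs))"
      unfolding decidable_def by (rule computable_cong) (auto simp: length_Suc_conv)
    show "\<exists>y. xs ! 0 = 0 \<or> odd (xs ! 0 div 2 ^ y)" for xs :: "nat list"
    proof (cases "xs ! 0 = 0")
      case False
      then obtain i q where "xs ! 0 + 2 = idx i q" using idx_surj[of "xs ! 0 + 2"] by force
      then have "xs ! 0 = 2 ^ q * (2 * i + 1)" by (simp add: idx_def)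
      then have "odd (xs ! 0 div 2 ^ q)" by (simp del: mult_Suc_right)
      then show ?thesis by blast
    qed simp
  qed
qed

lemma computable_odd_part: "computable n f \<Longrightarrow> computable n (\<lambda>xs. odd_part (f xs))"
  unfolding odd_part_def by (intro computable_intros computable_val2)

lemma computable_hole: "computable n f \<Longrightarrow> computable n (\<lambda>xs. hole (f xs))"
proof (rule computable_comp1[where f = hole])
  show "computable 1 (\<lambda>xs. hole (xs ! 0))"
    unfolding hole_def
  proof (rule computable_LEAST)
    have "decidable (Suc 1) (\<lambda>xs. even (xs ! 1 div 4 ^ (xs ! 0 + 3)))"
      by (intro computable_intros) auto
    then show "decidable (Suc 1) (\<lambda>xs. even (tl xs ! 0 div 4 ^ (hd xs + 3)))"
      unfolding decidable_def by (rule computable_cong) (auto simp: length_Suc_conv)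
    show "\<exists>k. even (xs ! 0 div 4 ^ (k + 3))" for xs :: "nat list"
      using even_hole by blast
  qed
qed

lemma indexed_family_lang: "indexed_family lang"
proof -
  have "computable 2 (\<lambda>xs. if
      xs ! 0 < 3 \<and> even (xs ! 1) \<and> (6 \<le> xs ! 1 \<or> xs ! 1 = 2 * xs ! 0) \<or>
      \<not> xs ! 0 < 3 \<and> (xs ! 1 = 2 * kind (xs ! 0) + 7 \<or>
        even (xs ! 1) \<and> (\<not> even (kind (xs ! 0) div 4 ^ (xs ! 1 div 2)) \<or>
          0 < ext (xs ! 0) \<and> (xs ! 1 = 2 * hole (kind (xs ! 0)) + 6 \<or>
            xs ! 1 = 2 * kind (xs ! 0) + 2 * ext (xs ! 0) + 6)))
      then 1 else 0)" (is "computable 2 ?f")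
    unfolding kind_def ext_def
    by (intro computable_intros computable_val2 computable_odd_part computable_hole; simp)
  moreover have "?f [p, x] = (if x \<in> lang p then 1 else 0)" for p x
    by (simp add: lang_def decoy_def fin_def)
  ultimately have "recursive2 (\<lambda>p x. if x \<in> lang p then 1 else 0)"
    unfolding recursive2_def computable_def by (metis (no_types, lifting) length_Cons list.size(3) numeral_2_eq_2)
  moreover have "lang p \<noteq> {}" for p
  proof -
    have "6 \<in> decoy p" by (simp add: decoy_def)
    then show ?thesis unfolding lang_def by (metis empty_iff marker_mem_fin)
  qed
  ultimately show ?thesis unfolding indexed_family_def by blast
qed

section \<open>Identification with history-bounded counterexamples\<close>

text \<open>The arguments of \<open>step\<close> are encoded by \<^const>\<open>enc_opt\<close>, so an example is odd iff its code is
  even and positive. From a decoy the marker \<open>2 * i + 7\<close> leads to \<open>idx i 1\<close>; from \<open>idx i q\<close> with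
  \<open>q > 0\<close> the counterexample tells whether to retract to \<open>idx i 0\<close> or to go on to \<open>idx i (q + 1)\<close>.\<close>

definition step :: "nat \<Rightarrow> nat \<Rightarrow> nat \<Rightarrow> nat" where
  "step p x c =
    (if p < 3 then (if even x \<and> 0 < x then 2 * x - 12 else if p < 2 \<and> 0 < c then p + 1 else p)
     else if \<not> even p \<or> c = 0 then p
     else if c \<le> odd_part (p - 2) + 7 then odd_part (p - 2) + 2
     else 2 * p - 2)"

definition hstep :: "nat \<Rightarrow> nat option \<Rightarrow> nat option \<Rightarrow> nat" where
  "hstep p x c = step p (enc_opt x) (enc_opt c)"

lemma recursive_hstep: "recursive_F hstep"
proof -
  have "computable 3 (\<lambda>xs. step (xs ! 0) (xs ! 1) (xs ! 2))"
    unfolding step_def by (intro computable_intros computable_odd_part; simp)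
  then obtain g where g: "total_rec 3 g"
      "\<And>xs. length xs = 3 \<Longrightarrow> g xs = step (xs ! 0) (xs ! 1) (xs ! 2)"
    unfolding computable_def by blast
  then have "g [p, enc_opt x, enc_opt c] = hstep p x c" for p x c
    by (simp add: hstep_def)
  then show ?thesis unfolding recursive_F_def using g(1) by blast
qed

text \<open>The marker has code \<open>x = 2 * i + 8\<close>, and
  \<open>2 * x - 12 = 4 * i + 4\<close> is \<open>idx i 1\<close>.\<close>

lemma hstep_decoy_marker: "p < 3 \<Longrightarrow> hstep p (Some (2 * i + 7)) c = idx i 1"
  by (simp add: hstep_def step_def enc_opt_def idx_def)

lemma hstep_decoy:
  assumes "p < 3" "\<And>y. x = Some y \<Longrightarrow> even y"
  shows "hstep p x c = (if p < 2 \<and> c \<noteq> None then p + 1 else p)"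
  using assms by (auto simp: hstep_def step_def enc_opt_def split: option.splits)

lemma even_idx: "even (idx i q) \<longleftrightarrow> 0 < q"
  by (auto simp: idx_def)

text \<open>Here \<open>odd_part (p - 2)\<close> is \<open>2 * i + 1\<close>, so adding 7 gives the
  code of the marker and adding 2 gives \<open>idx i 0\<close>; \<open>2 * p - 2\<close> doubles the
  power of two.\<close>

lemma hstep_idx:
  "hstep (idx i q) x c = (case c of None \<Rightarrow> idx i q
     | Some m \<Rightarrow> if q = 0 then idx i q else if m \<le> 2 * i + 7 then idx i 0 else idx i (q + 1))"
proof -
  have "idx i 0 = 2 * i + 3" "2 * idx i q - 2 = idx i (q + 1)" by (simp_all add: idx_def)
  then show ?thesis
    using idx_ge[of i q] by (auto simp: hstep_def step_def enc_opt_def even_idx split: option.splits)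
qed

text \<open>Each change lowers a natural number; the induction restarts after a change away from
  \<open>h N\<close>.\<close>

lemma eventually_constant:
  fixes h rk :: "nat \<Rightarrow> nat"
  assumes "\<And>n. N \<le> n \<Longrightarrow> h (Suc n) = h n \<or> rk (h (Suc n)) < rk (h n)"
  shows "\<exists>M\<ge>N. \<forall>n\<ge>M. h n = h M"
  using assms
proof (induction "rk (h N)" arbitrary: N rule: less_induct)
  case less
  show ?case
  proof (cases "\<forall>n\<ge>N. h n = h N")
    case False
    then obtain n where n: "N \<le> n" "h n \<noteq> h N" by blast
    have "\<exists>k\<ge>N. h k = h N \<and> h (Suc k) \<noteq> h k"
    proof (rule ccontr)
      assume "\<not> ?thesis"
      then have step: "N \<le> k \<Longrightarrow> h k = h N \<Longrightarrow> h (Suc k) = h N" for k by metis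
      have "h k = h N" if "N \<le> k" for k
        using that by (induction k rule: dec_induct) (auto intro: step)
      then show False using n by blast
    qed
    then obtain k where k: "N \<le> k" "h k = h N" "h (Suc k) \<noteq> h k" by blast
    then have "rk (h (Suc k)) < rk (h N)" using less.prems by metis
    moreover have "h (Suc n) = h n \<or> rk (h (Suc n)) < rk (h n)" if "Suc k \<le> n" for n
      using less.prems that k(1) by simp
    ultimately obtain M where "M \<ge> Suc k" "\<forall>n\<ge>M. h n = h M" using less.hyps by blast
    then show ?thesis using k(1) by (meson Suc_leD le_trans)
  qed blast
qed

lemma hcheck_ok_Some:
  "hcheck_ok L H hist (Some m) \<Longrightarrow> m \<in> H \<and> m \<notin> L \<and> (\<exists>t\<in>hist. m < t)"
  by (auto simp: hcheck_ok_def split: if_splits)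

lemma hcheck_ok_None:
  "hcheck_ok L H hist None \<Longrightarrow> m \<in> H \<Longrightarrow> m \<notin> L \<Longrightarrow> t \<in> hist \<Longrightarrow> t \<le> m"
  by (auto simp: hcheck_ok_def split: if_splits simp: not_less)

lemma history_subset: "is_trace L \<tau> \<Longrightarrow> history \<tau> n \<subseteq> L"
  by (auto simp: is_trace_def SMPL_def history_def)

lemma eventually_in_history:
  assumes "is_trace L \<tau>" "x \<in> L"
  obtains N where "\<And>n. N \<le> n \<Longrightarrow> x \<in> history \<tau> n"
proof -
  obtain k where "\<tau> k = Some x" using assms by (auto simp: is_trace_def SMPL_def)
  then have "x \<in> history \<tau> n" if "Suc k \<le> n" for n using that by (auto simp: history_def Suc_le_eq)
  then show thesis by (rule that)
qed

text \<open>All examples are even, so the run climbs from 0 through the decoys and stops at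
  \<open>t\<close>, where no counterexample exists. A smaller \<open>p\<close> is left because
  \<open>2 * p\<close> refutes it and is below 6, a member of every decoy.\<close>

lemma hcegis_identifies_decoy:
  assumes t: "t < 3" and tr: "is_trace (lang t) \<tau>"
    and ok: "\<And>n. hcheck_ok (lang t) (lang (run hstep 0 \<tau> cex n)) (history \<tau> n) (cex n)"
  shows "converges_to lang (run hstep 0 \<tau> cex) t"
proof -
  let ?r = "run hstep 0 \<tau> cex"
  have ev: "even y" if "\<tau> n = Some y" for n y
    using that tr t decoy_even by (auto simp: is_trace_def SMPL_def lang_decoy)
  have le: "?r n \<le> t" for n
  proof (induction n)
    case (Suc n)
    show ?case
    proof (cases "?r n = t")
      case True
      then have "cex n = None" using ok[of n] by (auto simp: hcheck_ok_def)
      then show ?thesis using True t ev hstep_decoy[of t "\<tau> n"] by auto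
    next
      case False
      then show ?thesis using Suc t ev hstep_decoy[of "?r n" "\<tau> n" "cex n"] by auto
    qed
  qed simp
  then have step: "?r (Suc n) = (if ?r n < 2 \<and> cex n \<noteq> None then ?r n + 1 else ?r n)" for n
    using hstep_decoy[of "?r n" "\<tau> n" "cex n"] t ev le[of n] by auto
  have "\<exists>M\<ge>0. \<forall>n\<ge>M. ?r n = ?r M"
  proof (rule eventually_constant[where rk = "\<lambda>p. t - p"])
    show "?r (Suc n) = ?r n \<or> t - ?r (Suc n) < t - ?r n" for n
      using step[of n] le[of "Suc n"] by auto
  qed
  then obtain M where M: "\<And>n. M \<le> n \<Longrightarrow> ?r n = ?r M" by auto
  have "?r M = t"
  proof (rule ccontr)
    assume neq: "?r M \<noteq> t"
    then have lt: "?r M < t" using le[of M] by simp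
    have "6 \<in> lang t" using t by (simp add: lang_decoy decoy_def)
    then obtain N where N: "\<And>n. N \<le> n \<Longrightarrow> 6 \<in> history \<tau> n"
      using eventually_in_history[OF tr] by blast
    let ?n = "max M N"
    have diff: "2 * ?r M \<in> lang (?r ?n)" "2 * ?r M \<notin> lang t"
      using M[of ?n] lt t by (simp_all add: lang_decoy)
    have "cex ?n = None"
    proof (rule ccontr)
      assume "cex ?n \<noteq> None"
      moreover have "?r ?n = ?r M" "?r (Suc ?n) = ?r M" using M[of ?n] M[of "Suc ?n"] by simp_all
      ultimately show False using step[of ?n] lt t by simp
    qed
    then have "hcheck_ok (lang t) (lang (?r ?n)) (history \<tau> ?n) None" using ok[of ?n] by (simp only:)
    then have "6 \<le> 2 * ?r M" using diff N[of ?n] by (rule hcheck_ok_None) simp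
    then show False using lt t by simp
  qed
  then have "lang (?r n) = lang t" if "M \<le> n" for n using M[OF that] by (simp only:)
  then show ?thesis unfolding converges_to_def by blast
qed

lemma hcegis_identifies_fin:
  assumes tr: "is_trace (fin i q) \<tau>"
    and ok: "\<And>n. hcheck_ok (fin i q) (lang (run hstep 0 \<tau> cex n)) (history \<tau> n) (cex n)"
  shows "converges_to lang (run hstep 0 \<tau> cex) (idx i q)"
proof -
  let ?r = "run hstep 0 \<tau> cex"
  have "\<exists>n. \<tau> n = Some (2 * i + 7)" using tr by (auto simp: is_trace_def SMPL_def)
  then obtain n0 where n0: "\<tau> n0 = Some (2 * i + 7)" "\<And>n. n < n0 \<Longrightarrow> \<tau> n \<noteq> Some (2 * i + 7)"
    using exists_least_iff[of "\<lambda>n. \<tau> n = Some (2 * i + 7)"] by blast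
  \<comment> \<open>The marker is the only odd member, so the hypothesis stays a decoy until it
    appears.\<close>
  have ev: "even y" if "\<tau> n = Some y" "n < n0" for n y
  proof (rule ccontr)
    assume "odd y"
    moreover have "y \<in> fin i q" using that(1) tr by (auto simp: is_trace_def SMPL_def)
    ultimately show False using n0(2)[OF that(2)] that(1) by (simp add: odd_mem_fin)
  qed
  have "n \<le> n0 \<Longrightarrow> ?r n < 3" for n
  proof (induction n)
    case (Suc n)
    then show ?case using hstep_decoy[of "?r n" "\<tau> n" "cex n"] ev by auto
  qed simp
  then have start: "?r (Suc n0) = idx i 1" using n0(1) by (simp add: hstep_decoy_marker)
  have marker: "2 * i + 7 \<in> history \<tau> n" if "Suc n0 \<le> n" for n
    using that n0(1) by (auto simp: history_def Suc_le_eq)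
  \<comment> \<open>In \<open>fin i 0\<close> the marker is the maximum, so every reported
    counterexample lies below it and triggers the retraction.\<close>
  have bound: "t \<le> 2 * i + 7" if "q = 0" "t \<in> history \<tau> n" for t n
  proof -
    have "t \<in> fin i 0" using that history_subset[OF tr] by auto
    then show ?thesis using bit4_less[of i "t div 2"] by (auto simp: fin_def)
  qed
  \<comment> \<open>For \<open>q = 0\<close> the run goes from \<open>r = 1\<close> down to 0,
    otherwise from 1 up to \<open>q\<close>.\<close>
  define Inv where "Inv p \<longleftrightarrow> (\<exists>r. p = idx i r \<and> (if q = 0 then r \<le> 1 else 1 \<le> r \<and> r \<le> q))" for p
  define rk where "rk p = (if q = 0 then ext p else q - ext p)" for p
  \<comment> \<open>Off the target, the run stays put without a drop in rank only if no
    counterexample was given. So a stable wrong hypothesis has no visible counterexample.\<close>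
  have inv: "Inv (?r n) \<and> (?r (Suc n) = ?r n \<and> (cex n = None \<or> ?r n = idx i q) \<or> rk (?r (Suc n)) < rk (?r n))"
    if "Suc n0 \<le> n" for n
  proof -
    have *: "Inv (?r (Suc n)) \<and> (?r (Suc n) = ?r n \<and> (cex n = None \<or> ?r n = idx i q) \<or> rk (?r (Suc n)) < rk (?r n))"
      if n: "Suc n0 \<le> n" and I: "Inv (?r n)" for n
    proof -
      obtain r where r: "?r n = idx i r" "if q = 0 then r \<le> 1 else 1 \<le> r \<and> r \<le> q"
        using I unfolding Inv_def by blast
      show ?thesis
      proof (cases "cex n")
        case None
        then show ?thesis using I r(1) by (simp add: hstep_idx)
      next
        case (Some m)
        then have m: "m \<in> fin i r" "m \<notin> fin i q" "\<exists>t\<in>history \<tau> n. m < t"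
          using hcheck_ok_Some ok[of n] r(1) by (metis lang_idx)+
        note d = fin_diff[OF m(1,2)]
        have neq: "r \<noteq> q" using m by auto
        show ?thesis
        proof (cases "q = 0")
          case True
          then have "m \<le> 2 * i + 7" using m(3) bound by (meson less_le_trans less_imp_le)
          then have "?r (Suc n) = idx i 0" using Some r(1) d(1) by (simp add: hstep_idx)
          then show ?thesis using True r d(1) by (auto simp: Inv_def rk_def)
        next
          case False
          \<comment> \<open>Both languages contain \<open>a\<^sub>i\<close>, so the counterexample
            is the \<open>y\<close> of \<open>fin i r\<close>, which lies above the marker.\<close>
          then have "m = 2 * i + 2 * r + 6" using d(2) by simp
          then have "?r (Suc n) = idx i (r + 1)" using Some r(1) d(1) by (simp add: hstep_idx)
          then show ?thesis using False r neq by (auto simp: Inv_def rk_def)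
        qed
      qed
    qed
    have "Inv (?r n)" using that
    proof (induction n rule: dec_induct)
      case base
      show ?case using start by (auto simp: Inv_def)
    next
      case (step n)
      then show ?case using * by blast
    qed
    then show ?thesis using * that by blast
  qed
  then obtain M where M: "Suc n0 \<le> M" "\<And>n. M \<le> n \<Longrightarrow> ?r n = ?r M"
    using eventually_constant[of "Suc n0" ?r rk] by blast
  have "?r M = idx i q"
  proof (rule ccontr)
    assume neq: "?r M \<noteq> idx i q"
    obtain r where r: "?r M = idx i r" "if q = 0 then r \<le> 1 else 1 \<le> r \<and> r \<le> q"
      using inv[OF M(1)] unfolding Inv_def by blast
    then have "r \<noteq> q" using neq by auto
    have none: "cex n = None" if "M \<le> n" for n
      using inv[of n] M that neq by (metis le_trans less_irrefl le_SucI)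
    have vis: "t \<le> m" if "M \<le> n" "m \<in> fin i r" "m \<notin> fin i q" "t \<in> history \<tau> n" for n m t
    proof -
      have "lang (?r n) = fin i r" using M(2)[OF that(1)] r(1) by (simp only: lang_idx)
      then have "hcheck_ok (fin i q) (fin i r) (history \<tau> n) None"
        using ok[of n] none[OF that(1)] by (simp only:)
      then show ?thesis using that(2-4) by (rule hcheck_ok_None)
    qed
    show False
    proof (cases "q = 0")
      case True
      then have "r = 1" using r \<open>r \<noteq> q\<close> by simp
      then have "2 * i + 7 \<le> 2 * hole i + 6"
        using vis[of M "2 * hole i + 6"] True marker[OF M(1)] by (simp add: fin_hole)
      then show False using hole_le[of i] by simp
    next
      case False
      then have rq: "0 < r" "r < q" using r \<open>r \<noteq> q\<close> by auto
      have "2 * i + 2 * q + 6 \<in> fin i q" using False fin_extra[of q i q] by simp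
      then obtain N where N: "\<And>n. N \<le> n \<Longrightarrow> 2 * i + 2 * q + 6 \<in> history \<tau> n"
        using eventually_in_history[OF tr] by blast
      have "2 * i + 2 * q + 6 \<le> 2 * i + 2 * r + 6"
        using vis[of "max M N" "2 * i + 2 * r + 6" "2 * i + 2 * q + 6"] rq N[of "max M N"]
          fin_extra[of r i r] fin_extra[of r i q] by simp
      then show False using rq by simp
    qed
  qed
  then have "lang (?r n) = lang (idx i q)" if "M \<le> n" for n using M(2)[OF that] by (simp only:)
  then show ?thesis unfolding converges_to_def by blast
qed

lemma in_HCEGIS_lang: "in_HCEGIS lang"
proof -
  have "hcegis_identifies lang hstep 0"
    unfolding hcegis_identifies_def
  proof (intro allI impI)
    fix p \<tau> cex
    assume A: "is_trace (lang p) \<tau>"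
      "\<forall>n. hcheck_ok (lang p) (lang (run hstep 0 \<tau> cex n)) (history \<tau> n) (cex n)"
    show "converges_to lang (run hstep 0 \<tau> cex) p"
    proof (cases "p < 3")
      case True
      then show ?thesis using hcegis_identifies_decoy A by blast
    next
      case False
      then obtain i q where "p = idx i q" using idx_surj[of p] by force
      then show ?thesis using hcegis_identifies_fin A by simp
    qed
  qed
  moreover have "engine lang hstep"
    unfolding engine_def using recursive_hstep inj_lang by blast
  ultimately show ?thesis unfolding in_HCEGIS_def using indexed_family_lang by blast
qed

section \<open>Failure of unbounded counterexamples\<close>

text \<open>The verifier answers by a function \<open>d\<close> of the current hypothesis alone, so
  this hypothesis and the remaining trace determine the rest of the run.\<close>

primrec play :: "(nat \<Rightarrow> nat option \<Rightarrow> nat option \<Rightarrow> nat) \<Rightarrow> (nat \<Rightarrow> nat option) \<Rightarrow> nat \<Rightarrow>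
    (nat \<Rightarrow> nat option) \<Rightarrow> nat \<Rightarrow> nat" where
  "play F d p \<tau> 0 = p"
| "play F d p \<tau> (Suc n) = F (play F d p \<tau> n) (\<tau> n) (d (play F d p \<tau> n))"

lemma run_eq_play: "run F p \<tau> (\<lambda>n. d (play F d p \<tau> n)) n = play F d p \<tau> n"
  by (induction n) auto

lemma play_add: "play F d p \<tau> (n + k) = play F d (play F d p \<tau> n) (\<lambda>j. \<tau> (n + j)) k"
  by (induction k) auto

lemma play_cong:
  assumes "\<And>k. k < n \<Longrightarrow> \<tau> k = \<tau>' k" "\<And>k. k < n \<Longrightarrow> d (play F d p \<tau> k) = d' (play F d p \<tau> k)"
  shows "play F d p \<tau> n = play F d' p \<tau>' n"
  using assms
proof (induction n)
  case (Suc n)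
  then have "play F d p \<tau> n = play F d' p \<tau>' n" by simp
  then show ?case using Suc.prems(1)[of n] Suc.prems(2)[of n] by simp
qed simp

definition canonical_trace :: "nat set \<Rightarrow> nat \<Rightarrow> nat option" where
  "canonical_trace L k = (if k \<in> L then Some k else None)"

lemma is_trace_canonical: "is_trace L (canonical_trace L)"
  by (auto simp: is_trace_def SMPL_def canonical_trace_def split: if_splits)

lemma finite_history: "finite (history \<tau> n)"
proof -
  have "history \<tau> n \<subseteq> (\<lambda>j. the (\<tau> j)) ` {..<n}" by (force simp: history_def)
  then show ?thesis by (rule finite_subset) simp
qed

text \<open>\<open>neutral p\<close> refutes hypothesis \<open>p\<close> for all decoys other than \<open>p\<close> and for all kinds other than that
  of \<open>p\<close>; \<open>reply t i\<close> never reports \<open>a\<^sub>i\<close>.\<close>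

definition neutral :: "nat \<Rightarrow> nat option" where
  "neutral p = Some (if p < 3 then 2 * p else 2 * kind p + 7)"

definition reply :: "nat \<Rightarrow> nat \<Rightarrow> nat \<Rightarrow> nat option" where
  "reply t i p = (if p = t then Some (2 * i + 8) else if p < 3 \<or> kind p \<noteq> i then neutral p
     else if ext p = 0 then None else Some (2 * i + 2 * ext p + 6))"

section \<open>Admissibility of the two kinds of answers\<close>

lemma check_okI: "m \<in> H \<Longrightarrow> m \<notin> L \<Longrightarrow> check_ok L H (Some m)"
  by (auto simp: check_ok_def)

lemma check_ok_neutral:
  assumes "t < 3" "p \<noteq> t"
  shows "check_ok (lang t) (lang p) (neutral p)"
proof (cases "p < 3")
  case True
  then show ?thesis
    using assms by (auto simp: neutral_def lang_decoy intro!: check_okI)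
next
  case False
  then obtain j r where p: "p = idx j r" using idx_surj[of p] by force
  have "2 * j + 7 \<notin> lang t" using assms decoy_even[of "2 * j + 7" t] by (auto simp: lang_decoy)
  then show ?thesis using False p by (auto simp: neutral_def intro!: check_okI)
qed

text \<open>Decoys other than \<open>t\<close> are refuted by \<open>2 * p\<close>, as
  \<open>E\<^sub>i\<close> contains at most \<open>2 * t\<close> among 0, 2, 4. The answer
  \<open>2 * i + 8\<close> at \<open>t\<close> is the \<open>y\<close> of \<open>fin i 1\<close>,
  whence \<open>q \<noteq> 1\<close>. Silence at \<open>idx i 0\<close> is correct since
  \<open>fin i 0\<close> is contained in the target.\<close>

lemma check_ok_reply:
  assumes t: "t < 3" and i: "\<And>n. n < 3 \<Longrightarrow> odd (i div 4 ^ n) \<Longrightarrow> n = t"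
    and q: "q \<noteq> 1" and p: "q = 0 \<or> p \<noteq> idx i q"
  shows "check_ok (fin i q) (lang p) (reply t i p)"
proof -
  consider (target) "p = t" | (decoy) "p \<noteq> t" "p < 3" | (fin) j r where "p = idx j r"
    using idx_surj[of p] by force
  then show ?thesis
  proof cases
    case target
    have "2 * i + 8 \<notin> fin i q" using fin_extra[of 1 i q] q by (simp add: add.commute)
    then show ?thesis using t target by (auto simp: reply_def lang_decoy decoy_def intro!: check_okI)
  next
    case decoy
    have "2 * p \<notin> fin i q" using i[of p] decoy by (auto simp: even_mem_fin)
    then show ?thesis using decoy by (auto simp: reply_def neutral_def lang_decoy intro!: check_okI)
  next
    case (fin j r)
    have [simp]: "\<not> idx j r < 3" "idx j r \<noteq> t" using idx_ge[of j r] t by auto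
    show ?thesis
    proof (cases "j = i")
      case False
      then show ?thesis using fin by (auto simp: reply_def neutral_def intro!: check_okI)
    next
      case True
      show ?thesis
      proof (cases "r = 0")
        case True
        moreover have "\<not> idx i 0 < 3" "idx i 0 \<noteq> t" using idx_ge[of i 0] t by auto
        ultimately show ?thesis
          using fin \<open>j = i\<close> fin_mono[of i q] by (simp add: reply_def check_ok_def)
      next
        case False
        then have "r \<noteq> q" using p fin \<open>j = i\<close> by auto
        moreover have "\<not> idx i r < 3" "idx i r \<noteq> t" using idx_ge[of i r] t by auto
        ultimately show ?thesis
          using False fin \<open>j = i\<close> fin_extra[of r i r] fin_extra[of r i q]
          by (auto simp: reply_def intro!: check_okI)
      qed
    qed
  qed
qed

lemma reply_eq_neutral: "p \<noteq> t \<Longrightarrow> p < 3 \<or> kind p \<noteq> i \<Longrightarrow> reply t i p = neutral p"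
  by (auto simp: reply_def)

section \<open>Kinds with a prescribed set \<open>E\<^sub>i\<close>\<close>

definition codes :: "nat set \<Rightarrow> nat set" where
  "codes D = {i. \<forall>n. odd (i div 4 ^ n) \<longleftrightarrow> n \<in> D}"

text \<open>The binary digits at even positions encode \<open>D\<close>; setting the free digit at
  position \<open>2 * r + 1\<close> gives a different code for each \<open>r\<close>.\<close>

lemma infinite_codes:
  assumes "finite D"
  shows "infinite (codes D)"
proof -
  define c where "c r = set_encode ((*) 2 ` D \<union> {2 * r + 1})" for r
  have fin: "finite ((*) 2 ` D \<union> {2 * r + 1})" for r using assms by simp
  have dec: "set_decode (c r) = (*) 2 ` D \<union> {2 * r + 1}" for r
    unfolding c_def using fin by (rule set_encode_inverse)
  have "c r \<in> codes D" for r
  proof -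
    have "odd (c r div 4 ^ n) \<longleftrightarrow> 2 * n \<in> set_decode (c r)" for n
      by (simp add: set_decode_def power_mult)
    then show ?thesis unfolding codes_def dec by (auto; presburger)
  qed
  moreover have "inj c"
  proof (rule injI)
    fix r s assume "c r = c s"
    then have "(*) 2 ` D \<union> {2 * r + 1} = (*) 2 ` D \<union> {2 * s + 1}" using dec by metis
    then have "2 * r + 1 \<in> (*) 2 ` D \<union> {2 * s + 1}" by blast
    then show "r = s" by auto presburger
  qed
  ultimately show ?thesis
    by (meson finite_imageD finite_subset image_subsetI infinite_UNIV_nat)
qed

lemma hole_codes:
  assumes "i \<in> codes D" "{3..<a} \<subseteq> D" "a \<notin> D" "3 \<le> a"
  shows "hole i = a - 3"
  unfolding hole_def
proof (rule Least_equality)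
  have "even (i div 4 ^ a)" using assms(1,3) unfolding codes_def by blast
  then show "even (i div 4 ^ (a - 3 + 3))" using assms(4) by simp
  show "a - 3 \<le> k" if "even (i div 4 ^ (k + 3))" for k
  proof (rule ccontr)
    assume "\<not> a - 3 \<le> k"
    then have "k + 3 \<in> D" using assms(2) by auto
    then show False using that assms(1) unfolding codes_def by blast
  qed
qed

section \<open>Defeating a hypothetical learner\<close>

locale cegis_learner =
  fixes F :: "nat \<Rightarrow> nat option \<Rightarrow> nat option \<Rightarrow> nat" and p0 :: nat
  assumes identifies: "cegis_identifies lang F p0"
begin

lemma play_converges:
  assumes "is_trace (lang p) \<tau>"
    and "\<And>n. check_ok (lang p) (lang (play F d p0 \<tau> n)) (d (play F d p0 \<tau> n))"
  shows "\<exists>N. \<forall>n\<ge>N. play F d p0 \<tau> n = p"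
proof -
  have "converges_to lang (run F p0 \<tau> (\<lambda>n. d (play F d p0 \<tau> n))) p"
    using identifies assms unfolding cegis_identifies_def by (simp add: run_eq_play)
  then show ?thesis unfolding converges_to_def by (metis run_eq_play inj_lang)
qed

definition first_visit :: "nat \<Rightarrow> (nat \<Rightarrow> nat option) \<Rightarrow> nat \<Rightarrow> bool" where
  "first_visit t \<tau> n \<longleftrightarrow> play F neutral p0 \<tau> n = t \<and> (\<forall>k<n. play F neutral p0 \<tau> k \<noteq> t)"

text \<open>Until \<open>t\<close> is visited, neutral answers are correct for the target
  \<open>decoy t\<close>; only the answer at \<open>t\<close> must become \<open>None\<close>.
  Identification then forces a visit.\<close>

lemma first_visit_exists:
  assumes t: "t < 3" and tr: "is_trace (lang t) \<tau>"
  shows "\<exists>n. first_visit t \<tau> n"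
proof -
  define d where "d p = (if p = t then None else neutral p)" for p
  have "check_ok (lang t) (lang p) (d p)" for p
    using check_ok_neutral[OF t] by (auto simp: d_def check_ok_def)
  then have "\<exists>n. play F d p0 \<tau> n = t" using play_converges[OF tr] by blast
  then obtain n where n: "play F d p0 \<tau> n = t" "\<And>k. k < n \<Longrightarrow> play F d p0 \<tau> k \<noteq> t"
    using exists_least_iff[of "\<lambda>n. play F d p0 \<tau> n = t"] by blast
  have "play F d p0 \<tau> k = play F neutral p0 \<tau> k" if "k \<le> n" for k
    using that n(2) by (intro play_cong) (auto simp: d_def)
  then show ?thesis using n unfolding first_visit_def by (metis less_imp_le order_refl)
qed

text \<open>After the first visit to the decoy \<open>t\<close> the learner only remembers \<open>t\<close>: the continuation below
  depends neither on \<open>\<tau>\<close> nor on \<open>q\<close>.\<close>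

lemma forgets_at_decoy:
  assumes t: "t < 3" and visit: "first_visit t \<tau> n"
    and kinds: "\<And>k. k < n \<Longrightarrow> i \<noteq> kind (play F neutral p0 \<tau> k)"
    and i: "\<And>n. n < 3 \<Longrightarrow> odd (i div 4 ^ n) \<Longrightarrow> n = t" and q: "q \<noteq> 1"
    and hist: "history \<tau> n \<subseteq> fin i q" "fin i q \<subseteq> history \<tau> n \<union> fin i 0"
    and unvisited: "\<And>k. q \<noteq> 0 \<Longrightarrow> play F (reply t i) t (canonical_trace (fin i 0)) k \<noteq> idx i q"
  shows "\<exists>N. \<forall>k\<ge>N. play F (reply t i) t (canonical_trace (fin i 0)) k = idx i q"
proof -
  \<comment> \<open>Up to the visit \<open>\<rho>\<close> follows \<open>\<tau>\<close>; then it
    lists \<open>fin i 0\<close>, the same for all \<open>q\<close>. By \<open>hist\<close> it is a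
    trace of \<open>fin i q\<close>.\<close>
  define \<rho> where "\<rho> k = (if k < n then \<tau> k else canonical_trace (fin i 0) (k - n))" for k
  have "SMPL \<rho> = history \<tau> n \<union> SMPL (canonical_trace (fin i 0))"
  proof
    show "SMPL \<rho> \<subseteq> history \<tau> n \<union> SMPL (canonical_trace (fin i 0))"
    proof
      fix x assume "x \<in> SMPL \<rho>"
      then obtain k where k: "\<rho> k = Some x" by (auto simp: SMPL_def)
      show "x \<in> history \<tau> n \<union> SMPL (canonical_trace (fin i 0))"
        using k unfolding \<rho>_def SMPL_def history_def by (cases "k < n") auto
    qed
    have "\<rho> k = \<tau> k" if "k < n" for k using that by (simp add: \<rho>_def)
    then have "history \<tau> n \<subseteq> SMPL \<rho>" unfolding SMPL_def history_def by fastforce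
    moreover have "SMPL (canonical_trace (fin i 0)) \<subseteq> SMPL \<rho>"
    proof
      fix x assume "x \<in> SMPL (canonical_trace (fin i 0))"
      then obtain k where "canonical_trace (fin i 0) k = Some x" unfolding SMPL_def by blast
      then have "\<rho> (n + k) = Some x" by (simp add: \<rho>_def)
      then show "x \<in> SMPL \<rho>" unfolding SMPL_def by blast
    qed
    ultimately show "history \<tau> n \<union> SMPL (canonical_trace (fin i 0)) \<subseteq> SMPL \<rho>" by blast
  qed
  then have tr: "is_trace (lang (idx i q)) \<rho>"
    using is_trace_canonical[of "fin i 0"] hist fin_mono[of i q] by (auto simp: is_trace_def)
  have pre: "play F neutral p0 \<tau> k = play F (reply t i) p0 \<rho> k" if "k \<le> n" for k
  proof (rule play_cong)
    fix j assume "j < k"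
    then have j: "j < n" using that by simp
    then show "\<tau> j = \<rho> j" by (simp add: \<rho>_def)
    have "play F neutral p0 \<tau> j \<noteq> t" using visit j unfolding first_visit_def by blast
    then show "neutral (play F neutral p0 \<tau> j) = reply t i (play F neutral p0 \<tau> j)"
      using kinds[OF j] by (simp add: reply_eq_neutral)
  qed
  have post: "play F (reply t i) p0 \<rho> (n + k) = play F (reply t i) t (canonical_trace (fin i 0)) k" for k
  proof -
    have "play F (reply t i) p0 \<rho> n = t" using pre[of n] visit unfolding first_visit_def by simp
    moreover have "(\<lambda>j. \<rho> (n + j)) = canonical_trace (fin i 0)" by (auto simp: \<rho>_def)
    ultimately show ?thesis by (metis play_add)
  qed
  have "check_ok (lang (idx i q)) (lang p) (reply t i p)" if "p = play F (reply t i) p0 \<rho> k" for p k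
  proof -
    \<comment> \<open>For \<open>q > 0\<close> the reply is wrong only at \<open>idx i q\<close>.
      Before the visit no hypothesis has kind \<open>i\<close>; afterwards \<open>unvisited\<close>
      applies.\<close>
    have "q = 0 \<or> p \<noteq> idx i q"
    proof (cases "k < n")
      case True
      then show ?thesis using kinds[of k] pre[of k] that by auto
    next
      case False
      then have "p = play F (reply t i) t (canonical_trace (fin i 0)) (k - n)"
        using post[of "k - n"] that by simp
      then show ?thesis using unvisited by auto
    qed
    then show ?thesis using check_ok_reply[OF t i q] by simp
  qed
  then obtain N where N: "\<And>k. N \<le> k \<Longrightarrow> play F (reply t i) p0 \<rho> k = idx i q"
    using play_converges[OF tr, of "reply t i"] by blast
  have "play F (reply t i) t (canonical_trace (fin i 0)) k = idx i q" if "N \<le> k" for k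
    using N[of "n + k"] that by (simp add: post)
  then show ?thesis by blast
qed

lemma no_cegis_learner: False
proof -
  have "\<forall>t. \<exists>n. t < 3 \<longrightarrow> first_visit t (canonical_trace (lang t)) n"
    using first_visit_exists is_trace_canonical by blast
  then obtain nb where nb: "\<And>t. t < 3 \<Longrightarrow> first_visit t (canonical_trace (lang t)) (nb t)"
    by metis
  define seen where "seen t = {n. 2 * n \<in> history (canonical_trace (lang t)) (nb t)}" for t
  have fin_seen: "finite (seen t)" for t
  proof -
    have "inj_on ((*) (2 :: nat)) A" for A by (simp add: inj_on_def)
    then have "finite ((*) 2 -` history (canonical_trace (lang t)) (nb t))"
      using finite_history by (rule finite_vimageI[rotated])
    then show ?thesis by (simp add: seen_def vimage_def)
  qed
  \<comment> \<open>The number \<open>a\<close> will be half of \<open>a\<^sub>i\<close>. It must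
    avoid the prefixes for all three decoys, since \<open>t\<close> is chosen depending on
    \<open>a\<close>.\<close>
  have "infinite (UNIV - ({..<3} \<union> (\<Union>t<3. seen t)) :: nat set)"
    using fin_seen by (intro Diff_infinite_finite) auto
  then obtain a where "a \<in> UNIV - ({..<3} \<union> (\<Union>t<3. seen t))"
    by (metis all_not_in_conv finite.emptyI)
  then have a: "3 \<le> a" "\<And>t. t < 3 \<Longrightarrow> a \<notin> seen t" by auto
  \<comment> \<open>Three decoys allow one that is not visited at times 0 and 1 of a trace starting
    with \<open>2 * a\<close>.\<close>
  have "\<exists>t<3. t \<noteq> u \<and> t \<noteq> v" for u v :: nat by presburger
  then obtain t where t: "t < 3" "t \<noteq> p0" "t \<noteq> F p0 (Some (2 * a)) (neutral p0)" by blast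

  \<comment> \<open>If \<open>E\<^sub>i\<close> consists of the doubles of a good \<open>D\<close>,
    then it contains the base prefix, \<open>a\<^sub>i\<close> is \<open>2 * a\<close>, and no decoy
    other than \<open>t\<close> has its private element in it.\<close>
  define good where "good D \<longleftrightarrow> finite D \<and> seen t \<union> {3..<a} \<subseteq> D \<and> a \<notin> D \<and> (\<forall>n\<in>D. n < 3 \<longrightarrow> n = t)" for D
  define base_kinds where "base_kinds = (\<lambda>k. kind (play F neutral p0 (canonical_trace (lang t)) k)) ` {..<nb t}"
  define after where "after i = play F (reply t i) t (canonical_trace (fin i 0))" for i

  have base: "\<exists>N. \<forall>k\<ge>N. after i k = idx i 0" if "good D" "i \<in> codes D" "i \<notin> base_kinds" for D i
    unfolding after_def
  proof (rule forgets_at_decoy[OF t(1) nb[OF t(1)]])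
    show "i \<noteq> kind (play F neutral p0 (canonical_trace (lang t)) k)" if "k < nb t" for k
      using \<open>i \<notin> base_kinds\<close> that by (auto simp: base_kinds_def)
    show "n = t" if "n < 3" "odd (i div 4 ^ n)" for n
      using \<open>good D\<close> \<open>i \<in> codes D\<close> that by (auto simp: good_def codes_def)
    show "history (canonical_trace (lang t)) (nb t) \<subseteq> fin i 0"
    proof
      fix x assume x: "x \<in> history (canonical_trace (lang t)) (nb t)"
      then have "x \<in> decoy t" using history_subset[OF is_trace_canonical] t(1) lang_decoy by blast
      then obtain n where n: "x = 2 * n" using decoy_even by blast
      then have "n \<in> D" using x \<open>good D\<close> by (auto simp: good_def seen_def)
      then show "x \<in> fin i 0" using n \<open>i \<in> codes D\<close> by (simp add: even_mem_fin codes_def)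
    qed
  qed auto
  \<comment> \<open>A sequence that is eventually constant takes finitely many values, so it meets
    \<open>idx i q\<close> for finitely many \<open>q\<close> only.\<close>
  have missed: "\<exists>M. \<forall>q>M. \<forall>k. after i k \<noteq> idx i q" if conv: "\<exists>N. \<forall>k\<ge>N. after i k = idx i 0" for i
  proof -
    obtain N where N: "\<And>k. N \<le> k \<Longrightarrow> after i k = idx i 0" using conv by blast
    define M where "M = Max (insert 0 ((\<lambda>k. ext (after i k)) ` {..<N}))"
    have "ext (after i k) \<le> M" for k
    proof (cases "k < N")
      case True
      then show ?thesis unfolding M_def by (intro Max_ge) auto
    next
      case False
      then show ?thesis using N[of k] by simp
    qed
    then have "after i k \<noteq> idx i q" if "M < q" for q k using that by (metis ext_idx not_less)
    then show ?thesis by blast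
  qed

  \<comment> \<open>The set \<open>V\<close> of kinds already tried will depend on the learner's
    reaction to \<open>y\<close>, so \<open>y\<close> must serve every \<open>V\<close> of bounded
    size: among \<open>n + 1\<close> prepared kinds one escapes \<open>V\<close>.\<close>
  have fresh: "\<exists>y. y \<notin> D \<and> 3 \<le> y \<and> y \<noteq> a \<and> (\<forall>V. finite V \<and> card V \<le> n \<longrightarrow>
      (\<exists>i q. i \<in> codes D \<and> i \<notin> V \<and> i \<notin> base_kinds \<and> 1 < q \<and> y = i + q + 3 \<and> (\<forall>k. after i k \<noteq> idx i q)))"
    if D: "good D" for D n
  proof -
    have "infinite (codes D - base_kinds)"
      using D infinite_codes[of D] by (auto simp: good_def base_kinds_def)
    then obtain I where I: "I \<subseteq> codes D - base_kinds" "card I = Suc n" "finite I"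
      using infinite_arbitrarily_large by blast
    have "\<exists>M. \<forall>q>M. \<forall>k. after i k \<noteq> idx i q" if "i \<in> I" for i
      using I(1) that D base[of D i] by (intro missed) blast
    then obtain M where M: "\<And>i q k. i \<in> I \<Longrightarrow> M i < q \<Longrightarrow> after i k \<noteq> idx i q" by metis
    \<comment> \<open>The summand 4 makes \<open>q = y - i - 3\<close> exceed
      \<open>M i + 1\<close>, hence also 1.\<close>
    obtain y where y: "\<And>b. b \<in> D \<union> {3, a} \<union> (\<lambda>i. i + M i + 4) ` I \<Longrightarrow> b < y"
    proof -
      have "finite (D \<union> {3, a} \<union> (\<lambda>i. i + M i + 4) ` I)" using D I by (simp add: good_def)
      then show thesis using that by (metis finite_nat_set_iff_bounded)
    qed
    have "\<exists>i q. i \<in> codes D \<and> i \<notin> V \<and> i \<notin> base_kinds \<and> 1 < q \<and> y = i + q + 3 \<and> (\<forall>k. after i k \<noteq> idx i q)"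
      if V: "finite V" "card V \<le> n" for V
    proof -
      have "\<not> I \<subseteq> V" using V I card_mono[of V I] by auto
      then obtain i where i: "i \<in> I" "i \<notin> V" by blast
      then have "i + M i + 4 < y" using y by blast
      then have "M i < y - i - 3" "1 < y - i - 3" "y = i + (y - i - 3) + 3" by auto
      then show ?thesis using i I(1) M by blast
    qed
    moreover have "y \<notin> D" "3 \<le> y" "y \<noteq> a" using y[of y] y[of 3] y[of a] by auto
    ultimately show ?thesis by blast
  qed
  then have "\<forall>D n. \<exists>y. good D \<longrightarrow> y \<notin> D \<and> 3 \<le> y \<and> y \<noteq> a \<and> (\<forall>V. finite V \<and> card V \<le> n \<longrightarrow>
      (\<exists>i q. i \<in> codes D \<and> i \<notin> V \<and> i \<notin> base_kinds \<and> 1 < q \<and> y = i + q + 3 \<and> (\<forall>k. after i k \<noteq> idx i q)))"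
    by blast
  then obtain Y where Y: "\<And>D n. good D \<Longrightarrow> Y D n \<notin> D \<and> 3 \<le> Y D n \<and> Y D n \<noteq> a \<and>
      (\<forall>V. finite V \<and> card V \<le> n \<longrightarrow> (\<exists>i q. i \<in> codes D \<and> i \<notin> V \<and> i \<notin> base_kinds \<and> 1 < q \<and>
        Y D n = i + q + 3 \<and> (\<forall>k. after i k \<noteq> idx i q)))"
    by metis

  \<comment> \<open>The trace is \<open>2 * a\<close>, \<open>2 * y 0\<close>, 0, \<open>2 * y 1\<close>, 2, \<open>2 * y 2\<close>, 4, ..., omitting the even numbers outside the
    decoy. Its prefixes of length \<open>2 * n + 2\<close> and \<open>2 * n + 3\<close> contain \<open>a\<close>, \<open>y n\<close> and elements of \<open>D n\<close>.\<close>
  define new where "new n = (if (3 \<le> n \<or> n = t) \<and> n \<noteq> a then {n} else {})" for n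
  \<comment> \<open>At most \<open>2 * n + 3\<close> steps precede the visit, which bounds the kinds
    tried. \<open>new n\<close> joins before \<open>y n\<close> is chosen, so that one
    \<open>D n\<close> serves both prefix lengths.\<close>
  define B where "B = rec_nat (seen t \<union> {3..<a}) (\<lambda>n S. insert (Y (S \<union> new n) (2 * n + 3)) (S \<union> new n))"
  define D where "D n = B n \<union> new n" for n
  define y where "y n = Y (D n) (2 * n + 3)" for n
  have B0: "B 0 = seen t \<union> {3..<a}" and BS: "B (Suc n) = insert (y n) (D n)" for n
    by (simp_all add: B_def D_def y_def)
  have good_new: "good (S \<union> new n)" if "good S" for S n
    using that by (auto simp: good_def new_def)
  have "seen t \<subseteq> {n. 3 \<le> n \<or> n = t}"
  proof
    fix n assume "n \<in> seen t"
    then have "2 * n \<in> decoy t"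
      using history_subset[OF is_trace_canonical] lang_decoy[OF t(1)] unfolding seen_def by blast
    then show "n \<in> {n. 3 \<le> n \<or> n = t}" by simp
  qed
  then have "good (B 0)" using fin_seen a t(1) by (auto simp: good_def B0)
  have goodB: "good (B n)" for n
  proof (induction n)
    case (Suc n)
    then have "good (D n)" using good_new by (simp add: D_def)
    then show ?case using Y[of "D n" "2 * n + 3"] unfolding BS y_def good_def by auto
  qed (fact \<open>good (B 0)\<close>)
  then have goodD: "good (D n)" for n using good_new by (simp add: D_def)
  have y: "3 \<le> y n" for n using Y[OF goodD] by (simp add: y_def)
  have monoD: "D m \<subseteq> D n" if "m \<le> n" for m n
    using that by (induction n rule: dec_induct) (auto simp: D_def BS)
  have y_in_D: "y m \<in> D n" if "m < n" for m n
    using monoD[of "Suc m" n] that by (auto simp: D_def BS)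

  define \<tau> where "\<tau> j = (case j of 0 \<Rightarrow> Some (2 * a)
     | Suc j \<Rightarrow> if even j then Some (2 * y (j div 2))
         else if new (j div 2) = {} then None else Some (2 * (j div 2)))" for j
  have "SMPL \<tau> = decoy t"
  proof
    show "SMPL \<tau> \<subseteq> decoy t"
    proof
      fix x assume "x \<in> SMPL \<tau>"
      then obtain j where "\<tau> j = Some x" by (auto simp: SMPL_def)
      then consider "x = 2 * a" | j' where "x = 2 * y j'" | j' where "x = 2 * j'" "new j' \<noteq> {}"
        by (auto simp only: \<tau>_def option.inject option.distinct split: nat.splits if_splits)
      then show "x \<in> decoy t"
        using a(1) y by cases (auto simp: new_def split: if_splits)
    qed
    show "decoy t \<subseteq> SMPL \<tau>"
    proof
      fix x assume x: "x \<in> decoy t"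
      then obtain n where n: "x = 2 * n" using decoy_even by blast
      have "\<tau> 0 = Some (2 * a)" by (simp add: \<tau>_def)
      moreover have "\<tau> (2 * n + 2) = Some (2 * n)" if "n \<noteq> a"
        using x n that by (simp add: \<tau>_def new_def)
      ultimately show "x \<in> SMPL \<tau>" using n by (cases "n = a") (auto simp: SMPL_def)
    qed
  qed
  then have "is_trace (lang t) \<tau>" using t(1) by (simp add: is_trace_def lang_decoy)
  then obtain m where visit: "first_visit t \<tau> m" using first_visit_exists t(1) by blast
  \<comment> \<open>By the choice of \<open>t\<close>; so both \<open>2 * a\<close> and
    \<open>2 * y 0\<close> have been shown by the time of the visit.\<close>
  have "m \<noteq> 0" "m \<noteq> 1"
    using visit t(2,3) unfolding first_visit_def by (metis play.simps(1), auto simp: \<tau>_def)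
  then obtain m' where m': "m = Suc (Suc m')" by (metis One_nat_def not0_implies_Suc)
  define n where "n = m' div 2"
  have mn: "2 * n + 2 \<le> m" "m \<le> 2 * n + 3" unfolding m' n_def by presburger+

  define V where "V = (\<lambda>k. kind (play F neutral p0 \<tau> k)) ` {..<m}"
  have "finite V" "card V \<le> 2 * n + 3"
    using card_image_le[of "{..<m}" "\<lambda>k. kind (play F neutral p0 \<tau> k)"] mn by (auto simp: V_def)
  then obtain i q where iq: "i \<in> codes (D n)" "i \<notin> V" "i \<notin> base_kinds" "1 < q" "y n = i + q + 3"
      "\<And>k. after i k \<noteq> idx i q"
    using Y[OF goodD, of n "2 * n + 3"] unfolding y_def by blast
  have hole: "hole i + 3 = a"
    using hole_codes[OF iq(1), of a] goodD[of n] a(1) by (auto simp: good_def)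
  \<comment> \<open>The even members of \<open>fin i q\<close> are exactly what the prefix may
    contain.\<close>
  have mem: "2 * k \<in> fin i q \<longleftrightarrow> k \<in> D n \<or> k = a \<or> k = y n" for k
    unfolding even_mem_fin using iq hole by (auto simp: codes_def)
  have "\<exists>N. \<forall>k\<ge>N. after i k = idx i q"
    unfolding after_def
  proof (rule forgets_at_decoy[OF t(1) visit])
    show "i \<noteq> kind (play F neutral p0 \<tau> k)" if "k < m" for k
      using iq(2) that by (auto simp: V_def)
    show "k = t" if "k < 3" "odd (i div 4 ^ k)" for k
      using goodD[of n] iq(1) that by (auto simp: good_def codes_def)
    show "q \<noteq> 1" using iq(4) by simp
    show "history \<tau> m \<subseteq> fin i q"
    proof
      fix x assume "x \<in> history \<tau> m"
      then obtain j where j: "j < m" "\<tau> j = Some x" by (auto simp: history_def)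
      show "x \<in> fin i q"
      proof (cases j)
        case 0
        then show ?thesis using j(2) mem[of a] by (auto simp: \<tau>_def)
      next
        case (Suc j')
        then have le: "j' div 2 \<le> n" using j(1) mn(2) by presburger
        show ?thesis
        proof (cases "even j'")
          case True
          then have "x = 2 * y (j' div 2)" using Suc j(2) by (simp add: \<tau>_def)
          then show ?thesis using mem y_in_D[of "j' div 2" n] le by (cases "j' div 2 = n") auto
        next
          case False
          then have "x = 2 * (j' div 2)" "j' div 2 \<in> new (j' div 2)"
            using Suc j(2) by (auto simp: \<tau>_def new_def split: if_splits)
          then show ?thesis using mem monoD[OF le] by (auto simp: D_def)
        qed
      qed
    qed
    have "2 * a \<in> history \<tau> m" using m' by (auto simp: history_def \<tau>_def intro!: exI[of _ 0])
    moreover have "2 * y n \<in> history \<tau> m"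
      unfolding history_def using mn(1) by (auto simp: \<tau>_def intro!: exI[of _ "Suc (2 * n)"])
    ultimately show "fin i q \<subseteq> history \<tau> m \<union> fin i 0"
      using hole iq(5) by (auto simp: fin_def)
    show "play F (reply t i) t (canonical_trace (fin i 0)) k \<noteq> idx i q" for k
      using iq(6) by (simp add: after_def)
  qed
  \<comment> \<open>The run after the visit would converge to \<open>idx i q\<close>, a hypothesis
    it never meets.\<close>
  then show False using iq(6) by blast
qed

end

lemma not_in_CEGIS_lang: "\<not> in_CEGIS lang"
  unfolding in_CEGIS_def using cegis_learner.no_cegis_learner cegis_learner.intro by blast

theorem lemma2:
  shows "\<exists>\<L>. indexed_family \<L> \<and> in_HCEGIS \<L> \<and> \<not> in_CEGIS \<L>"
  using indexed_family_lang in_HCEGIS_lang not_in_CEGIS_lang by blast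

end
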